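(* For every $\delta>0$ and $d,M\in\mathbb{N}$ there exists $N_0$ such that for every $N\ge N_0$ the following holds. If $A\subseteq[N]^d$ satisfies $|A|\ge\delta N^d$ and $B_1,\dots,B_d$ are $M$-homogeneous sets of positive integers, then there exist $x,x'\in A$ and $y_1\in B_1,\dots,y_d\in B_d$ such that $$x-x'=(y_1^2,\dots,y_d^2).$$
   Context: $[N]=\{1,\dots,\lfloor N\rfloor\}$. For $q\in\mathbb{N}$, $q\cdot[M]=\{q,2q,\dots,Mq\}$. A set $B$ of positive integers is $M$-homogeneous if $B\cap q\cdot[M]\neq\emptyset$ for every $q\in\mathbb{N}$. *)

theory Defs
  imports Complex_Main "HOL-Library.FuncSet"
begin

definition interval_upto :: "real \<Rightarrow> int set" where
  "interval_upto N = {1..\<lfloor>N\<rfloor>}"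

(* The points of [N]^d are the functions on {1..d}, extended by undefined outside {1..d},
   so that cardinalities of sets of points are the usual ones. *)
definition box :: "nat \<Rightarrow> real \<Rightarrow> (nat \<Rightarrow> int) set" where
  "box d N = {1..d} \<rightarrow>\<^sub>E interval_upto N"

(* Here q ranges over positive integers; the requirement that B consists of positive
   integers is part of the definition. *)
definition homogeneous :: "nat \<Rightarrow> int set \<Rightarrow> bool" where
  "homogeneous M B \<longleftrightarrow>
     (\<forall>b\<in>B. b > 0) \<and> (\<forall>q>0. B \<inter> (\<lambda>m. q * m) ` interval_upto (real M) \<noteq> {})"

end

theory Submission
  imports Defs "HOL-Analysis.Convex" "HOL-Library.Indicator_Function"
begin

text \<open>
  It suffices to find one \<open>q > 0\<close> such that \<open>q\<^sup>2 (m\<^sub>1\<^sup>2, \<dots>, m\<^sub>d\<^sup>2)\<close> lies in \<open>A - A\<close> for all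
  \<open>m \<in> [M]\<^sup>d\<close> at once: homogeneity then provides \<open>m\<close> with \<open>q m\<^sub>i \<in> B\<^sub>i\<close>. Applied to the power of \<open>A\<close>
  indexed by the finite set \<open>V\<close> of the vectors \<open>(m\<^sub>1\<^sup>2, \<dots>, m\<^sub>d\<^sup>2)\<close>, and to lines whose direction is the
  tuple of all elements of \<open>V\<close>, an averaging argument reduces this to the
  Furstenberg--Sarkozy theorem on square differences in dense sets of integers.

  For the latter, let \<open>\<kappa>\<close> be the limiting maximal density of sets without square differences.
  Pull-backs along progressions with square step again have no square differences, so an almost
  extremal set has density at most about \<open>\<kappa>\<close> on every long progression with square step,
  hence on every long progression. Its balanced function \<open>f\<close> therefore has small mean on
  almost all progressions. If \<open>\<kappa> > 0\<close>, the absence of square differences makes the averages of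
  \<open>f (n + (u + k)\<^sup>2)\<close> over \<open>n\<close> in the set, \<open>u < R\<close> and \<open>k \<le> K\<close> large and negative, whereas
  after the shift by \<open>u\<^sup>2\<close> and one Cauchy--Schwarz inequality they are controlled by means of
  \<open>f\<close> along progressions of step \<open>2 h\<close> with \<open>h \<le> K\<close>.
\<close>

section \<open>Sets without square differences and their density on progressions\<close>

definition square_diff_free :: "int set \<Rightarrow> bool" where
  "square_diff_free A \<longleftrightarrow> (\<forall>a\<in>A. \<forall>q>0. a + q\<^sup>2 \<notin> A)"

text \<open>Asking for one length \<open>L\<close> is enough: a bound at \<open>L\<close> passes to
  all progressions of \<open>L\<close> terms with square step, and by cutting into blocks to long
  progressions of any positive step.\<close>

definition density_bounds :: "real set" where
  "density_bounds = {c. \<exists>L\<ge>1. \<forall>A\<subseteq>{1..int L}. square_diff_free A \<longrightarrow> real (card A) \<le> c * real L}"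

lemma square_diff_free_dilate:
  assumes "square_diff_free A" "t > 0"
  shows "square_diff_free {j. a + t\<^sup>2 * j \<in> A}"
  unfolding square_diff_free_def
proof (intro ballI allI impI)
  fix j q :: int assume j: "j \<in> {j. a + t\<^sup>2 * j \<in> A}" and q: "q > 0"
  have "(a + t\<^sup>2 * j) + (t * q)\<^sup>2 \<notin> A"
    using assms j q unfolding square_diff_free_def by simp
  then show "j + q\<^sup>2 \<notin> {j. a + t\<^sup>2 * j \<in> A}"
    by (simp add: algebra_simps power_mult_distrib)
qed

lemma square_diff_free_subset: "square_diff_free A \<Longrightarrow> B \<subseteq> A \<Longrightarrow> square_diff_free B"
  unfolding square_diff_free_def by blast

text \<open>The indices of the points of \<open>A\<close> on the progression again form a set
  without square differences, so the bound at length \<open>L\<close> is uniform in \<open>a\<close>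
  and \<open>t\<close>.\<close>

lemma sum_square_step_progression_le:
  assumes bound: "\<forall>A\<subseteq>{1..int L}. square_diff_free A \<longrightarrow> real (card A) \<le> c * real L"
    and free: "square_diff_free A" and "t > 0"
  shows "(\<Sum>j<L. indicat_real A (a + t\<^sup>2 * int j)) \<le> c * real L"
proof -
  \<comment> \<open>Starting at \<open>a - t\<^sup>2\<close> converts indices counted from 0 into
    indices counted from 1.\<close>
  let ?J = "{j \<in> {1..int L}. (a - t\<^sup>2) + t\<^sup>2 * j \<in> A}"
  have "square_diff_free ?J"
    by (rule square_diff_free_subset[OF square_diff_free_dilate[OF free \<open>t > 0\<close>]]) auto
  then have "real (card ?J) \<le> c * real L"
    using bound[rule_format, of ?J] by fastforce
  moreover have "bij_betw (\<lambda>j. int j + 1) {j \<in> {..<L}. a + t\<^sup>2 * int j \<in> A} ?J"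
    by (rule bij_betw_byWitness[where f' = "\<lambda>j. nat (j - 1)"]) (auto simp: algebra_simps)
  then have "card {j \<in> {..<L}. a + t\<^sup>2 * int j \<in> A} = card ?J"
    by (rule bij_betw_same_card)
  moreover have "(\<Sum>j<L. indicat_real A (a + t\<^sup>2 * int j))
      = real (card {j \<in> {..<L}. a + t\<^sup>2 * int j \<in> A})"
    by (simp add: indicator_def sum.If_cases Int_def)
  ultimately show ?thesis by simp
qed

lemma sum_lessThan_mult:
  fixes h :: "nat \<Rightarrow> real"
  shows "(\<Sum>u<m * k. h u) = (\<Sum>j<m. \<Sum>i<k. h (j * k + i))"
proof -
  have "sum h {j * k..<j * k + k} = (\<Sum>i<k. h (j * k + i))" for j
    by (rule sum.reindex_bij_witness[where i = "\<lambda>i. j * k + i" and j = "\<lambda>u. u - j * k"]) auto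
  then show ?thesis unfolding sum.nat_group[symmetric] by simp
qed

text \<open>Sorting the \<open>L * t\<close> indices of a block by residue modulo \<open>t\<close>
  splits it into \<open>t\<close> progressions of step \<open>t\<^sup>2\<close> with
  \<open>L\<close> terms each.\<close>

lemma sum_progression_le:
  fixes g :: "int \<Rightarrow> real"
  assumes "\<And>a. (\<Sum>j<L. g (a + (int t)\<^sup>2 * int j)) \<le> c * real L"
  shows "(\<Sum>u<m * (L * t). g (a + int t * int u)) \<le> c * real (m * (L * t))"
proof -
  have block: "(\<Sum>u<L * t. g (b + int t * int u)) \<le> c * real (L * t)" for b
  proof -
    have "(\<Sum>u<L * t. g (b + int t * int u))
        = (\<Sum>i<t. \<Sum>j<L. g ((b + int t * int i) + (int t)\<^sup>2 * int j))"
      unfolding sum_lessThan_mult by (subst sum.swap) (simp add: algebra_simps power2_eq_square)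
    also have "\<dots> \<le> (\<Sum>i<t. c * real L)"
      by (intro sum_mono assms)
    finally show ?thesis by (simp add: algebra_simps)
  qed
  have "(\<Sum>u<m * (L * t). g (a + int t * int u))
      = (\<Sum>j<m. \<Sum>u<L * t. g ((a + int t * int (j * (L * t))) + int t * int u))"
    unfolding sum_lessThan_mult[of _ m] by (simp add: algebra_simps)
  also have "\<dots> \<le> (\<Sum>j<m. c * real (L * t))"
    by (intro sum_mono block)
  finally show ?thesis by (simp add: algebra_simps)
qed

section \<open>Mean size of sums along progressions\<close>

lemma sum_shift:
  fixes g :: "int \<Rightarrow> real"
  assumes "finite I" "\<And>n. g n \<noteq> 0 \<Longrightarrow> n \<in> I \<and> n - s \<in> I"
  shows "(\<Sum>n\<in>I. g (n + s)) = (\<Sum>n\<in>I. g n)"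
  by (rule sum.reindex_bij_witness_not_neutral[where S' = "{n\<in>I. g (n + s) = 0}"
        and T' = "{n\<in>I. g n = 0}" and i = "\<lambda>n. n - s" and j = "\<lambda>n. n + s"])
     (use assms in auto)

text \<open>One-sided bounds suffice, since \<open>\<bar>x\<bar> = 2 * max x 0 - x\<close> and the
  progression sums have nonnegative total. Progressions inside \<open>{1..int N}\<close> are bounded
  by \<open>prog\<close>, those crossing an end trivially by \<open>R\<close>.\<close>

lemma sum_abs_progression_sums_le:
  fixes f :: "int \<Rightarrow> real"
  assumes f_le: "\<And>n. \<bar>f n\<bar> \<le> 1" and supp: "\<And>n. n \<notin> {1..int N} \<Longrightarrow> f n = 0"
    and tot: "(\<Sum>n\<in>{1..int N}. f n) \<ge> 0" and "\<epsilon> \<ge> 0"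
    and prog: "\<And>a. 1 \<le> a \<Longrightarrow> a + int t * int R \<le> int N \<Longrightarrow>
      (\<Sum>u<R. f (a + int t * int u)) \<le> \<epsilon> * real R"
    and Y: "t * R \<le> Y"
  defines "I \<equiv> {1 - int Y..int N + int Y}"
  shows "(\<Sum>n\<in>I. \<bar>\<Sum>u<R. f (n + int t * int u)\<bar>) \<le> 2 * (real R * (\<epsilon> * real N + 2 * real (t * R)))"
proof -
  define G where "G n = (\<Sum>u<R. f (n + int t * int u))" for n
  \<comment> \<open>\<open>J2\<close> and \<open>J3\<close> collect the starting points whose
    progression may cross the left or the right end.\<close>
  define J1 J2 J3 where "J1 = {1..int N}" and "J2 = {1 - int (t * R)..0}"
    and "J3 = {int N - int (t * R) + 1..int N}"
  define H where "H (n::int) = \<epsilon> * real R * indicat_real J1 n + real R * indicat_real J2 n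
      + real R * indicat_real J3 n" for n
  have tu: "int t * int u \<le> int (t * R)" if "u < R" for u
    using that by (simp add: mult_left_mono)
  have G_le: "\<bar>G n\<bar> \<le> real R" for n
  proof -
    have "\<bar>G n\<bar> \<le> (\<Sum>u<R. \<bar>f (n + int t * int u)\<bar>)" unfolding G_def by (rule sum_abs)
    also have "\<dots> \<le> (\<Sum>u<R. 1)" by (intro sum_mono f_le)
    finally show ?thesis by simp
  qed
  have H_nn: "H n \<ge> 0" for n unfolding H_def using \<open>\<epsilon> \<ge> 0\<close> by (auto simp: indicator_def)
  have "max (G n) 0 \<le> H n" for n
  proof -
    \<comment> \<open>In the last two cases the progression misses \<open>{1..int N}\<close>
      altogether, so \<open>G n = 0\<close>.\<close>
    consider "n \<in> J2 \<or> n \<in> J3" | "1 \<le> n" "n + int t * int R \<le> int N"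
      | "n > int N" | "n \<le> - int (t * R)"
      unfolding J2_def J3_def by force
    then show ?thesis
    proof cases
      case 1
      then have "H n \<ge> real R" unfolding H_def using \<open>\<epsilon> \<ge> 0\<close> by (auto simp: indicator_def)
      then show ?thesis using G_le[of n] by linarith
    next
      case 2
      then have "n \<in> J1" unfolding J1_def by (auto intro: order_trans[rotated])
      then have "H n \<ge> \<epsilon> * real R" unfolding H_def by (auto simp: indicator_def)
      then show ?thesis using prog[OF 2] H_nn[of n] unfolding G_def by linarith
    next
      case 3
      have "f (n + int t * int u) = 0" for u using 3 
        by (intro supp) (smt (verit) atLeastAtMost_iff of_nat_0_le_iff zero_le_mult_iff)
      then show ?thesis using H_nn[of n] unfolding G_def by simp
    next
      case 4
      have "f (n + int t * int u) = 0" if "u < R" for u using 4 tu[OF that] by (intro supp) auto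
      then show ?thesis using H_nn[of n] unfolding G_def by simp
    qed
  qed
  then have "(\<Sum>n\<in>I. max (G n) 0) \<le> (\<Sum>n\<in>I. H n)" by (intro sum_mono)
  also have "\<dots> = \<epsilon> * real R * real (card (I \<inter> J1)) + real R * real (card (I \<inter> J2))
      + real R * real (card (I \<inter> J3))"
    unfolding H_def by (simp add: sum.distrib sum_distrib_left[symmetric] I_def indicator_def
        sum.If_cases Int_def)
  also have "\<dots> \<le> \<epsilon> * real R * real (card J1) + real R * real (card J2) + real R * real (card J3)"
    using \<open>\<epsilon> \<ge> 0\<close>
    by (intro add_mono mult_left_mono of_nat_mono card_mono) (simp_all add: J1_def J2_def J3_def)
  also have "\<dots> = real R * (\<epsilon> * real N + 2 * real (t * R))"
    by (simp add: J1_def J2_def J3_def algebra_simps)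
  finally have pos: "(\<Sum>n\<in>I. max (G n) 0) \<le> real R * (\<epsilon> * real N + 2 * real (t * R))" .
  \<comment> \<open>The margin \<open>Y\<close> keeps every translate of the support inside
    \<open>I\<close>, so each sum equals the full total of \<open>f\<close>.\<close>
  have nonneg: "(\<Sum>n\<in>I. f (n + int t * int u)) \<ge> 0" if "u < R" for u
  proof -
    have "(\<Sum>n\<in>I. f (n + int t * int u)) = (\<Sum>n\<in>I. f n)"
    proof (rule sum_shift)
      fix n assume "f n \<noteq> 0"
      then have "1 \<le> n" "n \<le> int N" using supp by force+
      moreover have "0 \<le> int t * int u" "int (t * R) \<le> int Y" using Y by (simp, linarith)
      ultimately show "n \<in> I \<and> n - int t * int u \<in> I"
        using tu[OF that] unfolding I_def atLeastAtMost_iff by (intro conjI) linarith+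
    qed (simp add: I_def)
    also have "\<dots> = (\<Sum>n\<in>{1..int N}. f n)"
      by (rule sum.mono_neutral_right) (auto simp: I_def supp)
    finally show ?thesis using tot by simp
  qed
  have "(\<Sum>n\<in>I. G n) \<ge> 0" unfolding G_def
    by (subst sum.swap, rule sum_nonneg) (simp add: nonneg)
  moreover have "\<bar>G n\<bar> = 2 * max (G n) 0 - G n" for n by auto
  ultimately have "(\<Sum>n\<in>I. \<bar>G n\<bar>) \<le> 2 * (\<Sum>n\<in>I. max (G n) 0)"
    by (simp add: sum_subtractf sum_distrib_left)
  then show ?thesis using pos unfolding G_def by linarith
qed

section \<open>A van der Corput inequality for square shifts\<close>

text \<open>Replacing \<open>n\<close> by \<open>n - u\<^sup>2\<close> frees the factor \<chi> from
  \<open>k\<close>, and Cauchy--Schwarz over the pairs \<open>(u, n)\<close> removes it. In the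
  expanded square over \<open>k\<close> and \<open>l\<close>, the two arguments of \<open>f\<close>
  differ by an amount linear in \<open>u\<close> with slope \<open>2 * (l - k)\<close>.\<close>

lemma van_der_corput_squares:
  fixes f \<chi> :: "int \<Rightarrow> real"
  assumes f_le: "\<And>n. \<bar>f n\<bar> \<le> 1" and f_supp: "\<And>n. n \<notin> {1..int N} \<Longrightarrow> f n = 0"
    and \<chi>_le: "\<And>n. \<bar>\<chi> n\<bar> \<le> 1" and \<chi>_supp: "\<And>n. n \<notin> {1..int N} \<Longrightarrow> \<chi> n = 0"
    and E: "\<And>h. 1 \<le> h \<Longrightarrow> h \<le> K \<Longrightarrow>
      (\<Sum>n\<in>{1 - int ((R + K)\<^sup>2)..int N + int ((R + K)\<^sup>2)}. \<bar>\<Sum>u<R. f (n + int (2 * h) * int u)\<bar>) \<le> E"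
    and "E \<ge> 0"
  shows "(\<Sum>u<R. \<Sum>k\<in>{1..K}. \<Sum>n\<in>{1..int N}. \<chi> n * f (n + (int u + int k)\<^sup>2))\<^sup>2
    \<le> (real R * real N) * (real K * real R * real N + (real K)\<^sup>2 * E)"
proof -
  \<comment> \<open>\<open>Y\<close> bounds every shift that occurs, so translations inside the
    window \<open>I\<close> lose no terms.\<close>
  define Y where "Y = int ((R + K)\<^sup>2)"
  define I where "I = {1 - Y..int N + Y}"
  have I: "finite I" "{1..int N} \<subseteq> I" unfolding I_def Y_def by auto
  define F where "F u n k = f (n + (2 * int u * int k + (int k)\<^sup>2))" for u k :: nat and n
  have shift_le: "2 * int u * int k + (int k)\<^sup>2 + (int u)\<^sup>2 \<le> Y" if "u < R" "k \<in> {1..K}" for u k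
  proof -
    have "2 * int u * int k + (int k)\<^sup>2 + (int u)\<^sup>2 = (int u + int k)\<^sup>2"
      by (simp add: power2_sum)
    also have "\<dots> \<le> (int R + int K)\<^sup>2" using that by (intro power_mono) auto
    finally show ?thesis unfolding Y_def by simp
  qed
  have shift_nn: "0 \<le> 2 * int u * int k \<and> 0 \<le> (int k)\<^sup>2 \<and> 0 \<le> (int u)\<^sup>2" for u k by auto
  have inI: "n - s \<in> I" if "n \<in> {1..int N}" "0 \<le> s" "s \<le> Y" for n s
    using that unfolding I_def by auto
  have sum_I: "(\<Sum>n\<in>I. g n) = (\<Sum>n\<in>{1..int N}. g n)" if "\<And>n. n \<notin> {1..int N} \<Longrightarrow> g n = 0"
    for g :: "int \<Rightarrow> real"
    using that I by (intro sum.mono_neutral_right) auto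
  have sum_N_le: "(\<Sum>n\<in>{1..int N}. g n) \<le> real N" if "\<And>n. g n \<le> 1" for g :: "int \<Rightarrow> real"
    using sum_mono[of "{1..int N}" g "\<lambda>_. 1"] that by simp

  have shifted: "(\<Sum>n\<in>{1..int N}. \<chi> n * f (n + (int u + int k)\<^sup>2))
      = (\<Sum>n\<in>I. \<chi> (n - (int u)\<^sup>2) * F u n k)"
    if "u < R" "k \<in> {1..K}" for u k
  proof -
    have "(\<Sum>n\<in>I. \<chi> (n - (int u)\<^sup>2) * F u n k)
        = (\<Sum>n\<in>I. \<chi> ((n + (int u)\<^sup>2) - (int u)\<^sup>2) * F u (n + (int u)\<^sup>2) k)"
    proof (rule sum_shift[symmetric])
      fix n assume "\<chi> (n - (int u)\<^sup>2) * F u n k \<noteq> 0"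
      then have "n - (int u)\<^sup>2 \<in> {1..int N}" using \<chi>_supp by (metis mult_eq_0_iff)
      then show "n \<in> I \<and> n - (int u)\<^sup>2 \<in> I"
        using shift_le[OF that] shift_nn[of u k]
        unfolding I_def atLeastAtMost_iff by (intro conjI) linarith+
    qed (rule I)
    also have "\<dots> = (\<Sum>n\<in>I. \<chi> n * f (n + (int u + int k)\<^sup>2))"
      unfolding F_def by (simp add: power2_sum algebra_simps)
    also have "\<dots> = (\<Sum>n\<in>{1..int N}. \<chi> n * f (n + (int u + int k)\<^sup>2))"
      by (rule sum_I) (simp add: \<chi>_supp)
    finally show ?thesis by simp
  qed
  have "(\<Sum>u<R. \<Sum>k\<in>{1..K}. \<Sum>n\<in>{1..int N}. \<chi> n * f (n + (int u + int k)\<^sup>2))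
      = (\<Sum>u<R. \<Sum>k\<in>{1..K}. \<Sum>n\<in>I. \<chi> (n - (int u)\<^sup>2) * F u n k)"
    by (rule sum.cong[OF refl], rule sum.cong[OF refl]) (simp add: shifted)
  also have "\<dots> = (\<Sum>u<R. \<Sum>n\<in>I. \<chi> (n - (int u)\<^sup>2) * (\<Sum>k\<in>{1..K}. F u n k))"
    by (subst sum.swap) (simp add: sum_distrib_left)
  also have "\<dots> = (\<Sum>(u, n)\<in>{..<R} \<times> I. \<chi> (n - (int u)\<^sup>2) * (\<Sum>k\<in>{1..K}. F u n k))"
    by (simp add: sum.cartesian_product)
  finally have "(\<Sum>u<R. \<Sum>k\<in>{1..K}. \<Sum>n\<in>{1..int N}. \<chi> n * f (n + (int u + int k)\<^sup>2))\<^sup>2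
      = (\<Sum>(u, n)\<in>{..<R} \<times> I. \<chi> (n - (int u)\<^sup>2) * (\<Sum>k\<in>{1..K}. F u n k))\<^sup>2"
    by simp
  also have "\<dots> \<le> (\<Sum>(u, n)\<in>{..<R} \<times> I. (\<chi> (n - (int u)\<^sup>2))\<^sup>2)
      * (\<Sum>(u, n)\<in>{..<R} \<times> I. (\<Sum>k\<in>{1..K}. F u n k)\<^sup>2)"
    unfolding case_prod_unfold by (rule Cauchy_Schwarz_ineq_sum)
  also have "\<dots> \<le> (real R * real N) * (real K * real R * real N + (real K)\<^sup>2 * E)"
  proof (rule mult_mono)
    have "(\<Sum>n\<in>I. (\<chi> (n - (int u)\<^sup>2))\<^sup>2) \<le> real N" if "u < R" for u
    proof -
      have u: "(int u)\<^sup>2 \<le> Y" unfolding Y_def of_nat_power using that by (intro power_mono) auto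
      have "(\<Sum>n\<in>I. (\<chi> (n - (int u)\<^sup>2))\<^sup>2) = (\<Sum>n\<in>I. (\<chi> ((n + (int u)\<^sup>2) - (int u)\<^sup>2))\<^sup>2)"
      proof (rule sum_shift[symmetric])
        fix n assume "(\<chi> (n - (int u)\<^sup>2))\<^sup>2 \<noteq> 0"
        then have "n - (int u)\<^sup>2 \<in> {1..int N}" using \<chi>_supp by (metis zero_power2)
        then show "n \<in> I \<and> n - (int u)\<^sup>2 \<in> I"
          using u zero_le_power2[of "int u"]
            unfolding I_def atLeastAtMost_iff by (intro conjI) linarith+
      qed (rule I)
      also have "\<dots> = (\<Sum>n\<in>{1..int N}. (\<chi> n)\<^sup>2)"
        by (simp, rule sum_I) (simp add: \<chi>_supp)
      also have "\<dots> \<le> real N"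
        by (rule sum_N_le) (use \<chi>_le in \<open>simp add: abs_square_le_1\<close>)
      finally show ?thesis .
    qed
    then show "(\<Sum>(u, n)\<in>{..<R} \<times> I. (\<chi> (n - (int u)\<^sup>2))\<^sup>2) \<le> real R * real N"
      using sum_mono[of "{..<R}" "\<lambda>u. \<Sum>n\<in>I. (\<chi> (n - (int u)\<^sup>2))\<^sup>2" "\<lambda>_. real N"]
      by (simp add: sum.cartesian_product[symmetric])
  next
    define C where "C k l = (\<Sum>u<R. \<Sum>n\<in>I. F u n k * F u n l)" for k l
    \<comment> \<open>Translating by \<open>2 * u * k + k\<^sup>2\<close> makes the first factor
      \<open>f n\<close>, independent of \<open>u\<close>.\<close>
    have C_eq: "C k l = (\<Sum>u<R. \<Sum>n\<in>{1..int N}.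
        f n * f (n + (2 * int u * (int l - int k) + ((int l)\<^sup>2 - (int k)\<^sup>2))))"
      if "k \<in> {1..K}" for k l
      unfolding C_def
    proof (rule sum.cong[OF refl])
      fix u assume u: "u \<in> {..<R}"
      let ?s = "2 * int u * int k + (int k)\<^sup>2"
      let ?g = "\<lambda>n. f n * f (n + (2 * int u * (int l - int k) + ((int l)\<^sup>2 - (int k)\<^sup>2)))"
      have "(\<Sum>n\<in>I. F u n k * F u n l) = (\<Sum>n\<in>I. ?g (n + ?s))"
        unfolding F_def by (simp add: algebra_simps)
      also have "\<dots> = (\<Sum>n\<in>I. ?g n)"
      proof (rule sum_shift)
        fix n assume "?g n \<noteq> 0"
        then have "n \<in> {1..int N}" using f_supp by force
        moreover have "?s + (int u)\<^sup>2 \<le> Y" using shift_le u that by simp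
        then have "0 \<le> ?s" "?s \<le> Y" using shift_nn[of u k] by linarith+
        ultimately show "n \<in> I \<and> n - ?s \<in> I" using I(2) inI by blast
      qed (rule I)
      also have "\<dots> = (\<Sum>n\<in>{1..int N}. ?g n)" by (rule sum_I) (simp add: f_supp)
      finally show "(\<Sum>n\<in>I. F u n k * F u n l) = (\<Sum>n\<in>{1..int N}. ?g n)" .
    qed
    have C_sym: "C k l = C l k" for k l unfolding C_def by (simp add: mult.commute)
    have C_diag: "C k k \<le> real R * real N" if "k \<in> {1..K}" for k
    proof -
      have "C k k = (\<Sum>u<R. \<Sum>n\<in>{1..int N}. f n * f n)" using C_eq[OF that, of k] by simp
      also have "\<dots> \<le> (\<Sum>u<R. real N)"
        by (intro sum_mono sum_N_le) (use f_le in \<open>simp add: abs_square_le_1 flip: power2_eq_square\<close>)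
      finally show ?thesis by simp
    qed
    have C_less: "C k l \<le> E" if k: "k \<in> {1..K}" and l: "l \<in> {1..K}" and "k < l" for k l
    proof -
      define h where "h = l - k"
      define s where "s = (int l)\<^sup>2 - (int k)\<^sup>2"
      have h: "1 \<le> h" "h \<le> K" "int l - int k = int h" using that unfolding h_def by auto
      have s: "0 \<le> s" "s \<le> Y"
      proof -
        show "0 \<le> s" unfolding s_def using \<open>k < l\<close> by (simp add: power_mono)
        have "s \<le> (int l)\<^sup>2" unfolding s_def by simp
        also have "\<dots> \<le> Y" unfolding Y_def of_nat_power using l by (intro power_mono) auto
        finally show "s \<le> Y" .
      qed
      \<comment> \<open>Now \<open>f n\<close> leaves the sum over \<open>u\<close>, and what
        remains is a sum of \<open>f\<close> along a progression of step
        \<open>2 * h\<close>.\<close>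
      have "C k l = (\<Sum>n\<in>{1..int N}. f n * (\<Sum>u<R. f ((n + s) + int (2 * h) * int u)))"
        unfolding C_eq[OF k] h s_def[symmetric]
        by (subst sum.swap) (simp add: sum_distrib_left algebra_simps)
      also have "\<dots> \<le> (\<Sum>n\<in>{1..int N}. \<bar>\<Sum>u<R. f ((n + s) + int (2 * h) * int u)\<bar>)"
      proof (rule sum_mono)
        fix n
        show "f n * x \<le> \<bar>x\<bar>" for x
          using mult_right_mono[OF f_le[of n], of "\<bar>x\<bar>"] abs_ge_self[of "f n * x"]
          by (simp add: abs_mult)
      qed
      also have "\<dots> = (\<Sum>n\<in>{1 + s..int N + s}. \<bar>\<Sum>u<R. f (n + int (2 * h) * int u)\<bar>)"
        by (rule sum.reindex_bij_witness[where i = "\<lambda>n. n - s" and j = "\<lambda>n. n + s"]) auto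
      also have "\<dots> \<le> (\<Sum>n\<in>I. \<bar>\<Sum>u<R. f (n + int (2 * h) * int u)\<bar>)"
        using s by (intro sum_mono2) (auto simp: I_def)
      also have "\<dots> \<le> E" using E[OF h(1,2)] unfolding I_def Y_def .
      finally show ?thesis .
    qed
    \<comment> \<open>As \<open>E \<ge> 0\<close>, it may be added on the diagonal too, which gives
      one bound for all pairs.\<close>
    have C_le: "C k l \<le> (if k = l then real R * real N else 0) + E"
      if "k \<in> {1..K}" "l \<in> {1..K}" for k l
      using C_diag[of k] C_less[of k l] C_less[of l k] C_sym[of k l] that \<open>E \<ge> 0\<close>
      by (cases k l rule: linorder_cases) auto
    have "(\<Sum>(u, n)\<in>{..<R} \<times> I. (\<Sum>k\<in>{1..K}. F u n k)\<^sup>2)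
        = (\<Sum>(u, n)\<in>{..<R} \<times> I. \<Sum>k\<in>{1..K}. \<Sum>l\<in>{1..K}. F u n k * F u n l)"
      by (simp add: power2_eq_square sum_product)
    also have "\<dots> = (\<Sum>k\<in>{1..K}. \<Sum>(u, n)\<in>{..<R} \<times> I. \<Sum>l\<in>{1..K}. F u n k * F u n l)"
      unfolding case_prod_unfold by (rule sum.swap)
    also have "\<dots> = (\<Sum>k\<in>{1..K}. \<Sum>l\<in>{1..K}. \<Sum>(u, n)\<in>{..<R} \<times> I. F u n k * F u n l)"
      unfolding case_prod_unfold by (rule sum.cong[OF refl], rule sum.swap)
    also have "\<dots> = (\<Sum>k\<in>{1..K}. \<Sum>l\<in>{1..K}. C k l)"
      by (simp add: C_def sum.cartesian_product)
    also have "\<dots> \<le> (\<Sum>k\<in>{1..K}. \<Sum>l\<in>{1..K}. (if k = l then real R * real N else 0) + E)"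
      by (intro sum_mono C_le)
    also have "\<dots> = real K * real R * real N + (real K)\<^sup>2 * E"
      by (simp add: sum.distrib power2_eq_square algebra_simps)
    finally show "(\<Sum>(u, n)\<in>{..<R} \<times> I. (\<Sum>k\<in>{1..K}. F u n k)\<^sup>2)
      \<le> real K * real R * real N + (real K)\<^sup>2 * E" .
  qed (auto intro!: sum_nonneg)
  finally show ?thesis .
qed

section \<open>The Furstenberg--Sarkozy theorem\<close>

lemma sum_indicat_real:
  "finite B \<Longrightarrow> (\<Sum>x\<in>B. indicat_real A x) = real (card (B \<inter> A))"
  by (simp add: indicator_def sum.If_cases Int_def)

text \<open>Otherwise there are sets without square differences of density above \<alpha> at every
  length. Such a set makes \<open>T\<close> very negative, while the bound \<alpha> + \<epsilon> on
  progressions and \<open>van_der_corput_squares\<close> keep \<open>T\<^sup>2\<close>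
  small.\<close>

lemma density_increment:
  assumes \<alpha>: "0 < \<alpha>" "\<alpha> \<le> 1" and mem: "\<alpha> + \<alpha> ^ 4 / 64 \<in> density_bounds"
  shows "\<alpha> \<in> density_bounds"
proof (rule ccontr)
  assume not_mem: "\<alpha> \<notin> density_bounds"
  define \<epsilon> where "\<epsilon> = \<alpha> ^ 4 / 64"
  obtain L where L: "L \<ge> 1"
    and bound: "\<forall>A\<subseteq>{1..int L}. square_diff_free A \<longrightarrow> real (card A) \<le> (\<alpha> + \<epsilon>) * real L"
    using mem unfolding density_bounds_def \<epsilon>_def mem_Collect_eq by blast
  \<comment> \<open>This makes the diagonal contribution \<open>N\<close> at most
    \<open>K * \<alpha> ^ 4 * N / 16\<close>.\<close>
  define K where "K = nat \<lceil>16 / \<alpha> ^ 4\<rceil>"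
  have K_ge: "16 / \<alpha> ^ 4 \<le> real K" unfolding K_def by linarith
  have "K > 0" unfolding K_def using \<alpha> by simp
  \<comment> \<open>The factorial makes \<open>R\<close> a multiple of \<open>2 * h * L\<close> for every \<open>h\<close> between \<open>1\<close> and \<open>K\<close>.\<close>
  define R where "R = fact K * (L * 2)"
  have "R > 0" unfolding R_def using L by simp
  define Y where "Y = (R + K)\<^sup>2"
  \<comment> \<open>The first summand limits the loss at the right end to half of
    \<open>\<alpha> * N\<close>; the second makes \<open>4 * K * R\<close> at most
    \<open>\<alpha> ^ 4 * N / 64\<close>.\<close>
  obtain N :: nat where N_ge: "2 * real Y / \<alpha> + 256 * real K * real R / \<alpha> ^ 4 + 1 \<le> real N"
    using real_arch_simple by blast
  have pos: "0 \<le> 2 * real Y / \<alpha>" "0 \<le> 256 * real K * real R / \<alpha> ^ 4"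
    using \<alpha> by auto
  have N1: "N \<ge> 1" using N_ge pos by linarith
  have "2 * real Y / \<alpha> \<le> real N" using N_ge pos by linarith
  then have NY: "2 * real Y \<le> \<alpha> * real N" using \<alpha> by (simp add: field_simps)
  have "256 * real K * real R / \<alpha> ^ 4 \<le> real N" using N_ge pos by linarith
  then have NKR: "256 * real K * real R \<le> \<alpha> ^ 4 * real N" using \<alpha> by (simp add: field_simps)
  obtain A where A: "A \<subseteq> {1..int N}" "square_diff_free A" "real (card A) > \<alpha> * real N"
    using not_mem N1 unfolding density_bounds_def mem_Collect_eq by (meson not_le)
  define \<chi> where "\<chi> = indicat_real A"
  \<comment> \<open>Subtracting \<alpha> instead of the exact density leaves a nonnegative total, as
    \<open>sum_abs_progression_sums_le\<close> requires.\<close>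
  define f where "f n = \<chi> n - \<alpha> * indicat_real {1..int N} n" for n
  define E where "E = 2 * (real R * (\<epsilon> * real N + 2 * (2 * real K * real R)))"
  have f_le: "\<bar>f n\<bar> \<le> 1" for n
    using \<alpha> unfolding f_def \<chi>_def by (auto simp: indicator_def)
  have f_supp: "f n = 0" if "n \<notin> {1..int N}" for n
    using that A(1) unfolding f_def \<chi>_def by (auto simp: indicator_def)
  have sum_\<chi>: "(\<Sum>n\<in>{1..int N}. \<chi> n) = real (card A)"
    using A(1) unfolding \<chi>_def by (simp add: sum_indicat_real inf.absorb2)
  define T where "T = (\<Sum>u<R. \<Sum>k\<in>{1..K}. \<Sum>n\<in>{1..int N}. \<chi> n * f (n + (int u + int k)\<^sup>2))"

  have "(\<Sum>n\<in>{1..int N}. \<chi> n * f (n + (int u + int k)\<^sup>2)) \<le> - (\<alpha>\<^sup>2 * real N / 2)"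
    if "u < R" "k \<in> {1..K}" for u k
  proof -
    define s where "s = (int u + int k)\<^sup>2"
    have "int u + int k > 0" using that by auto
    then have s_A: "n + s \<notin> A" if "n \<in> A" for n
      using A(2) that unfolding square_diff_free_def s_def by blast
    have s: "0 \<le> s" "s \<le> int Y"
      unfolding s_def Y_def of_nat_power using that by (auto intro!: power_mono)
    define J where "J = {int N - int Y + 1..int N}"
    \<comment> \<open>For \<open>n\<close> in \<open>A\<close> the point \<open>n + s\<close> is not
      in \<open>A\<close>, so \<open>f (n + s) = - \<alpha>\<close> unless \<open>n + s\<close>
      exceeds \<open>N\<close>; then \<open>n\<close> lies in \<open>J\<close>.\<close>
    have "\<chi> n * f (n + s) \<le> \<alpha> * indicat_real J n - \<alpha> * \<chi> n" if "n \<in> {1..int N}" for n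
    proof (cases "n \<in> A")
      case True
      then show ?thesis using that s s_A[OF True] \<alpha> unfolding f_def \<chi>_def J_def
        by (auto simp: indicator_def)
    qed (use \<alpha> in \<open>auto simp: \<chi>_def\<close>)
    then have "(\<Sum>n\<in>{1..int N}. \<chi> n * f (n + s))
        \<le> (\<Sum>n\<in>{1..int N}. \<alpha> * indicat_real J n - \<alpha> * \<chi> n)"
      by (rule sum_mono)
    also have "\<dots> = \<alpha> * real (card ({1..int N} \<inter> J)) - \<alpha> * real (card A)"
      by (simp add: sum_subtractf sum_\<chi> sum_indicat_real flip: sum_distrib_left)
    also have "\<dots> \<le> \<alpha> * real (card J) - \<alpha> * (\<alpha> * real N)"
      using \<alpha> A(3) by (intro diff_mono mult_left_mono of_nat_mono card_mono) (auto simp: J_def)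
    also have "\<dots> = \<alpha> * (real Y - \<alpha> * real N)"
      by (simp add: J_def algebra_simps)
    also have "\<dots> \<le> \<alpha> * (- (\<alpha> * real N / 2))"
      using \<alpha> NY by (intro mult_left_mono) auto
    finally show ?thesis unfolding s_def by (simp add: power2_eq_square)
  qed
  then have "T \<le> (\<Sum>u<R. \<Sum>k\<in>{1..K}. - (\<alpha>\<^sup>2 * real N / 2))"
    unfolding T_def by (intro sum_mono) auto
  then have T_le: "real R * real K * (\<alpha>\<^sup>2 * real N / 2) \<le> - T"
    by (simp add: algebra_simps)

  have "T\<^sup>2 \<le> (real R * real N) * (real K * real R * real N + (real K)\<^sup>2 * E)"
    unfolding T_def
  proof (rule van_der_corput_squares[OF f_le f_supp])
    fix h assume h: "1 \<le> h" "h \<le> K"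
    have "(\<Sum>n\<in>{1 - int Y..int N + int Y}. \<bar>\<Sum>u<R. f (n + int (2 * h) * int u)\<bar>)
        \<le> 2 * (real R * (\<epsilon> * real N + 2 * real (2 * h * R)))"
    proof (rule sum_abs_progression_sums_le[OF f_le f_supp])
      show "0 \<le> (\<Sum>n\<in>{1..int N}. f n)"
        using A(3) by (simp add: f_def sum_subtractf sum_\<chi> mult.commute[of \<alpha>] flip: sum_distrib_left)
      show "0 \<le> \<epsilon>" unfolding \<epsilon>_def using \<alpha> by simp
      have "2 * h * R \<le> 2 * K * R" using h by simp
      also have "\<dots> \<le> Y" unfolding Y_def by (simp add: power2_sum)
      finally show "2 * h * R \<le> Y" .
    next
      fix a assume a: "1 \<le> a" "a + int (2 * h) * int R \<le> int N"
      obtain m where "fact K = h * m" using dvd_fact[OF h] by (auto elim: dvdE)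
      then have m: "R = m * (L * (2 * h))" unfolding R_def by simp
      \<comment> \<open>The bound holds for step \<open>(2 * h)\<^sup>2\<close>, hence for step
        \<open>2 * h\<close> and \<open>R\<close> terms; subtracting \<alpha> leaves an excess of at
        most \<open>\<epsilon> * R\<close>.\<close>
      have "(\<Sum>j<L. indicat_real A (a + (int (2 * h))\<^sup>2 * int j)) \<le> (\<alpha> + \<epsilon>) * real L" for a
        by (rule sum_square_step_progression_le[OF bound A(2)]) (use h in simp)
      then have "(\<Sum>u<R. \<chi> (a + int (2 * h) * int u)) \<le> (\<alpha> + \<epsilon>) * real R"
        unfolding m \<chi>_def by (rule sum_progression_le)
      moreover have "f (a + int (2 * h) * int u) = \<chi> (a + int (2 * h) * int u) - \<alpha>" if "u < R" for u
      proof -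
        have "int (2 * h) * int u \<le> int (2 * h) * int R" using that by (intro mult_left_mono) auto
        moreover have "0 \<le> int (2 * h) * int u" by simp
        ultimately have "a + int (2 * h) * int u \<in> {1..int N}"
          using a unfolding atLeastAtMost_iff by linarith
        then show ?thesis unfolding f_def by simp
      qed
      then have "(\<Sum>u<R. f (a + int (2 * h) * int u))
          = (\<Sum>u<R. \<chi> (a + int (2 * h) * int u)) - \<alpha> * real R"
        by (simp add: sum_subtractf)
      ultimately show "(\<Sum>u<R. f (a + int (2 * h) * int u)) \<le> \<epsilon> * real R"
        by (simp add: algebra_simps)
    qed
    also have "\<dots> \<le> E"
      unfolding E_def using h by (intro mult_left_mono add_left_mono) (auto intro!: mult_right_mono)
    finally show "(\<Sum>n\<in>{1 - int ((R + K)\<^sup>2)..int N + int ((R + K)\<^sup>2)}.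
        \<bar>\<Sum>u<R. f (n + int (2 * h) * int u)\<bar>) \<le> E"
      unfolding Y_def .
  qed (use A(1) \<alpha> in \<open>auto simp: \<chi>_def E_def \<epsilon>_def indicator_def\<close>)
  moreover have "(real R * real K * (\<alpha>\<^sup>2 * real N / 2))\<^sup>2 \<le> (- T)\<^sup>2"
    using T_le \<alpha> by (intro power_mono) auto
  ultimately have "(real R * real K * (\<alpha>\<^sup>2 * real N / 2))\<^sup>2
      \<le> (real R * real N) * (real K * real R * real N + (real K)\<^sup>2 * E)" by simp
  then have "((real R)\<^sup>2 * real N * real K) * (real K * (\<alpha> ^ 4 * real N) / 4)
      \<le> ((real R)\<^sup>2 * real N * real K) * (real N + 2 * real K * (\<epsilon> * real N + 4 * real K * real R))"
    unfolding E_def by (simp add: power2_eq_square power_numeral_reduce algebra_simps)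
  then have main: "real K * (\<alpha> ^ 4 * real N) / 4
      \<le> real N + 2 * real K * (\<epsilon> * real N + 4 * real K * real R)"
    using \<open>K > 0\<close> \<open>R > 0\<close> N1 by (subst (asm) mult_le_cancel_left_pos) auto
  \<comment> \<open>Each of the two terms on the right of \<open>main\<close> is at most
    \<open>K * \<alpha> ^ 4 * N / 16\<close>, together half of the left side.\<close>
  have "\<epsilon> * real N + 4 * real K * real R \<le> \<alpha> ^ 4 * real N / 32"
    using NKR unfolding \<epsilon>_def by (simp add: algebra_simps)
  then have "2 * real K * (\<epsilon> * real N + 4 * real K * real R) \<le> 2 * real K * (\<alpha> ^ 4 * real N / 32)"
    by (intro mult_left_mono) auto
  moreover have "16 * real N \<le> real K * \<alpha> ^ 4 * real N"
    using K_ge \<alpha> by (intro mult_right_mono) (auto simp: field_simps)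
  moreover have "real K * \<alpha> ^ 4 * real N > 0" using \<open>K > 0\<close> \<alpha> N1 by simp
  ultimately show False using main by (simp add: algebra_simps)
qed

text \<open>The infimum \<kappa> of the density bounds must vanish: otherwise
  \<open>density_increment\<close> yields a bound below it.\<close>

lemma sarkozy_squares:
  assumes "\<delta> > 0"
  obtains L where "L \<ge> 1"
    "\<And>A. A \<subseteq> {1..int L} \<Longrightarrow> real (card A) \<ge> \<delta> * real L \<Longrightarrow> \<exists>a\<in>A. \<exists>q>0. a + q\<^sup>2 \<in> A"
proof -
  define \<kappa> where "\<kappa> = Inf density_bounds"
  have nonneg: "0 \<le> c" if c: "c \<in> density_bounds" for c
  proof -
    obtain L where L: "L \<ge> 1"
      "\<forall>A\<subseteq>{1..int L}. square_diff_free A \<longrightarrow> real (card A) \<le> c * real L"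
      using c unfolding density_bounds_def mem_Collect_eq by blast
    have "0 \<le> c * real L" using L(2)[rule_format, of "{}"] by (simp add: square_diff_free_def)
    then show ?thesis using L(1) by (simp add: zero_le_mult_iff)
  qed
  then have bdd: "bdd_below density_bounds" by (rule bdd_belowI)
  have one: "1 \<in> density_bounds"
    unfolding density_bounds_def
    by (auto intro!: exI[of _ "1::nat"] dest: card_mono[rotated])
  have up: "c' \<in> density_bounds" if "c \<in> density_bounds" "c \<le> c'" for c c'
    using that unfolding density_bounds_def mem_Collect_eq
    by (meson mult_right_mono of_nat_0_le_iff order_trans)
  have "0 \<le> \<kappa>" unfolding \<kappa>_def using one nonneg by (intro cInf_greatest) auto
  have "\<kappa> \<le> 1" unfolding \<kappa>_def using one bdd by (rule cInf_lower)
  have "\<kappa> = 0"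
  proof (rule ccontr)
    assume "\<kappa> \<noteq> 0"
    then have "\<kappa> > 0" using \<open>0 \<le> \<kappa>\<close> by simp
    \<comment> \<open>\<open>\<alpha>\<close> lies so little below \<open>\<kappa>\<close> that \<open>\<alpha> + \<alpha> ^ 4 / 64\<close> still exceeds \<open>\<kappa>\<close>.\<close>
    define \<alpha> where "\<alpha> = \<kappa> - \<kappa> ^ 4 / 2000"
    have "\<kappa> ^ 4 \<le> \<kappa>" using power_decreasing[of 1 4 \<kappa>] \<open>0 \<le> \<kappa>\<close> \<open>\<kappa> \<le> 1\<close> by simp
    then have \<alpha>: "\<kappa> / 2 \<le> \<alpha>" "0 < \<alpha>" "\<alpha> < \<kappa>" "\<alpha> \<le> 1"
      using \<open>\<kappa> > 0\<close> \<open>\<kappa> \<le> 1\<close> zero_less_power[of \<kappa> 4] unfolding \<alpha>_def by linarith+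
    have "(\<kappa> / 2) ^ 4 \<le> \<alpha> ^ 4" using \<alpha> \<open>\<kappa> > 0\<close> by (intro power_mono) auto
    then have "\<kappa> ^ 4 / 16 \<le> \<alpha> ^ 4" by (simp add: power_divide)
    moreover have "\<kappa> = \<alpha> + \<kappa> ^ 4 / 2000" unfolding \<alpha>_def by simp
    ultimately have "\<kappa> < \<alpha> + \<alpha> ^ 4 / 64"
      using zero_less_power[OF \<open>\<kappa> > 0\<close>, of 4] by linarith
    then obtain c where "c \<in> density_bounds" "c < \<alpha> + \<alpha> ^ 4 / 64"
      using one cInf_lessD[of density_bounds "\<alpha> + \<alpha> ^ 4 / 64"] unfolding \<kappa>_def by blast
    then have "\<alpha> + \<alpha> ^ 4 / 64 \<in> density_bounds" using up less_imp_le by blast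
    then have "\<alpha> \<in> density_bounds" using density_increment \<alpha> by blast
    then show False using cInf_lower[OF _ bdd] \<alpha>(3) unfolding \<kappa>_def by fastforce
  qed
  then obtain c where c: "c \<in> density_bounds" "c < \<delta>"
    using assms one cInf_lessD[of density_bounds \<delta>] unfolding \<kappa>_def by fastforce
  then obtain L where L: "L \<ge> 1"
    "\<forall>A\<subseteq>{1..int L}. square_diff_free A \<longrightarrow> real (card A) \<le> c * real L"
    unfolding density_bounds_def mem_Collect_eq by blast
  show ?thesis
  proof (rule that[OF L(1)])
    fix A assume A: "A \<subseteq> {1..int L}" "real (card A) \<ge> \<delta> * real L"
    have "c * real L < \<delta> * real L" using c L(1) by simp
    then have "\<not> square_diff_free A" using L(2)[rule_format, OF A(1)] A(2) by linarith
    then show "\<exists>a\<in>A. \<exists>q>0. a + q\<^sup>2 \<in> A" unfolding square_diff_free_def by auto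
  qed
qed

section \<open>One square multiplier for finitely many directions\<close>

text \<open>Take one base point \<open>X v\<close> per direction and let \<open>S X\<close> be the
  times \<open>t\<close> at which all points \<open>X v + t * v\<close> lie in \<open>A\<close>.
  Some \<open>S X\<close> is dense, and a square difference in it serves every \<open>v\<close> at
  once.\<close>

lemma simultaneous_square_recurrence:
  fixes \<delta> :: real and d :: nat and V :: "(nat \<Rightarrow> int) set"
  assumes "\<delta> > 0" and V: "finite V"
  shows "\<exists>n\<^sub>0. \<forall>n\<ge>n\<^sub>0. \<forall>A. A \<subseteq> {1..d} \<rightarrow>\<^sub>E {1..int n} \<longrightarrow> real (card A) \<ge> \<delta> * real n ^ d \<longrightarrow>
    (\<exists>q>0. \<forall>v\<in>V. \<exists>x\<in>A. \<exists>x'\<in>A. \<forall>i\<in>{1..d}. x i - x' i = q\<^sup>2 * v i)"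
proof -
  \<comment> \<open>\<open>A\<close> fills at least \<open>\<delta> / 3 ^ d\<close> of the enlarged
    box, whose side is at most \<open>3 * n\<close>; independent choices over \<open>V\<close> give
    the power.\<close>
  define \<eta> where "\<eta> = (\<delta> / 3 ^ d) ^ card V"
  have "\<eta> > 0" unfolding \<eta>_def using assms by simp
  then obtain L where L: "L \<ge> 1"
    and sarkozy: "\<And>S. S \<subseteq> {1..int L} \<Longrightarrow> real (card S) \<ge> \<eta> * real L \<Longrightarrow> \<exists>a\<in>S. \<exists>q>0. a + q\<^sup>2 \<in> S"
    using sarkozy_squares by blast
  define C where "C = (\<Sum>v\<in>V. \<Sum>i\<in>{1..d}. \<bar>v i\<bar>)"
  have C: "\<bar>v i\<bar> \<le> C" if "v \<in> V" "i \<in> {1..d}" for v i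
  proof -
    have "\<bar>v i\<bar> \<le> (\<Sum>i\<in>{1..d}. \<bar>v i\<bar>)" using that by (intro member_le_sum) auto
    also have "\<dots> \<le> C" unfolding C_def using that V by (intro member_le_sum) (auto intro: sum_nonneg)
    finally show ?thesis .
  qed
  have "C \<ge> 0" unfolding C_def by (intro sum_nonneg) auto
  define Z where "Z = nat (int L * C)"
  have Z: "int Z = int L * C" unfolding Z_def using \<open>C \<ge> 0\<close> by simp
  have tv: "\<bar>t * v i\<bar> \<le> int Z" if "t \<in> {1..int L}" "v \<in> V" "i \<in> {1..d}" for t v i
    unfolding Z abs_mult using that C by (intro mult_mono) auto
  show ?thesis
  proof (intro exI[of _ "Z + 1"] allI impI)
    fix n and A :: "(nat \<Rightarrow> int) set"
    assume n: "Z + 1 \<le> n" and A: "A \<subseteq> {1..d} \<rightarrow>\<^sub>E {1..int n}" and cardA: "\<delta> * real n ^ d \<le> real (card A)"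
    \<comment> \<open>The margin \<open>Z\<close> bounds all displacements \<open>t * v i\<close>,
      so every translate of \<open>A\<close> by \<open>- t * v\<close> fits and exactly
      \<open>card A\<close> base points reach \<open>A\<close> at time \<open>t\<close>.\<close>
    define box' where "box' = {1..d} \<rightarrow>\<^sub>E {1 - int Z..int n + int Z}"
    have finite_box': "finite box'" unfolding box'_def by (intro finite_PiE) auto
    have card_box': "card box' = (n + 2 * Z) ^ d"
      unfolding box'_def by (simp add: card_PiE nat_add_distrib mult_2 add.assoc flip: of_nat_add)
    define shift where "shift t v x = (\<lambda>i\<in>{1..d}. x i + t * v i)" for t :: int and v x :: "nat \<Rightarrow> int"
    have card_shift: "card {x \<in> box'. shift t v x \<in> A} = card A" if "t \<in> {1..int L}" "v \<in> V" for t v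
    proof (rule bij_betw_same_card[of "shift t v"], rule bij_betw_byWitness[where f' = "shift (- t) v"])
      have inv: "shift (- s) v (shift s v x) = x" if "x \<in> extensional {1..d}" for s x
        using that unfolding shift_def extensional_def by (auto simp: fun_eq_iff restrict_def)
      show "\<forall>x\<in>{x \<in> box'. shift t v x \<in> A}. shift (- t) v (shift t v x) = x"
        using inv by (auto simp: box'_def PiE_def)
      show inv': "\<forall>x\<in>A. shift t v (shift (- t) v x) = x"
        using inv[of _ "- t"] A by (auto simp: PiE_def)
      have "shift (- t) v x \<in> box'" if "x \<in> A" for x
      proof -
        have "x i - t * v i \<in> {1 - int Z..int n + int Z}" if i: "i \<in> {1..d}" for i
        proof -
          have "x i \<in> {1..int n}" using \<open>x \<in> A\<close> A i by (blast dest: PiE_mem)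
          then show ?thesis using tv[OF \<open>t \<in> {1..int L}\<close> \<open>v \<in> V\<close> i]
            unfolding atLeastAtMost_iff by linarith
        qed
        then show ?thesis unfolding box'_def shift_def by auto
      qed
      then show "shift (- t) v ` A \<subseteq> {x \<in> box'. shift t v x \<in> A}" using inv' by auto
    qed auto
    define \<X> where "\<X> = V \<rightarrow>\<^sub>E box'"
    have finite_\<X>: "finite \<X>" unfolding \<X>_def using V finite_box' by (intro finite_PiE) auto
    have card_\<X>: "card \<X> = card box' ^ card V" unfolding \<X>_def using V by (simp add: card_PiE)
    define S where "S X = {t \<in> {1..int L}. \<forall>v\<in>V. shift t v (X v) \<in> A}" for X
    have "(\<Sum>X\<in>\<X>. real (card (S X))) = (\<Sum>X\<in>\<X>. \<Sum>t\<in>{1..int L}. of_bool (\<forall>v\<in>V. shift t v (X v) \<in> A))"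
      unfolding S_def by (simp add: sum_of_bool_eq Int_def)
    also have "\<dots> = (\<Sum>t\<in>{1..int L}. real (card {X \<in> \<X>. \<forall>v\<in>V. shift t v (X v) \<in> A}))"
      using finite_\<X> by (subst sum.swap) (simp add: sum_of_bool_eq Int_def)
    also have "\<dots> = (\<Sum>t\<in>{1..int L}. real (card A ^ card V))"
    proof (rule sum.cong[OF refl])
      fix t assume t: "t \<in> {1..int L}"
      \<comment> \<open>The conditions for different \<open>v\<close> constrain different
        coordinates of \<open>X\<close>, so the counts multiply.\<close>
      have "{X \<in> \<X>. \<forall>v\<in>V. shift t v (X v) \<in> A} = (\<Pi>\<^sub>E v\<in>V. {x \<in> box'. shift t v x \<in> A})"
        unfolding \<X>_def by (auto simp: PiE_def Pi_def)
      then show "real (card {X \<in> \<X>. \<forall>v\<in>V. shift t v (X v) \<in> A}) = real (card A ^ card V)"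
        using V t by (simp add: card_PiE card_shift)
    qed
    finally have total: "(\<Sum>X\<in>\<X>. real (card (S X))) = real L * real (card A) ^ card V" by simp
    have "\<exists>X\<in>\<X>. real (card (S X)) \<ge> \<eta> * real L"
    proof (rule ccontr)
      assume "\<not> (\<exists>X\<in>\<X>. real (card (S X)) \<ge> \<eta> * real L)"
      then have less: "real (card (S X)) < \<eta> * real L" if "X \<in> \<X>" for X
        using that by (auto simp: not_le)
      have "box' \<noteq> {}" unfolding box'_def using n by (auto simp: PiE_eq_empty_iff)
      then have "\<X> \<noteq> {}" unfolding \<X>_def by (auto simp: PiE_eq_empty_iff)
      then have "real L * real (card A) ^ card V < real (card \<X>) * (\<eta> * real L)"
        using sum_strict_mono[of \<X> "\<lambda>X. real (card (S X))" "\<lambda>_. \<eta> * real L"] less finite_\<X> total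
        by simp
      also have "\<dots> = real L * (\<delta> / 3 ^ d * real (n + 2 * Z) ^ d) ^ card V"
        by (simp add: card_\<X> card_box' \<eta>_def power_mult_distrib power_divide mult.commute)
      also have "\<dots> \<le> real L * (\<delta> / 3 ^ d * real (3 * n) ^ d) ^ card V"
        using n \<open>\<delta> > 0\<close> by (intro mult_left_mono power_mono) auto
      also have "\<dots> = real L * (\<delta> * real n ^ d) ^ card V"
        by (simp add: power_mult_distrib)
      also have "\<dots> \<le> real L * real (card A) ^ card V"
        using cardA \<open>\<delta> > 0\<close> by (intro mult_left_mono power_mono) auto
      finally show False by simp
    qed
    then obtain X where "\<eta> * real L \<le> real (card (S X))" by blast
    moreover have "S X \<subseteq> {1..int L}" unfolding S_def by auto
    ultimately obtain t q where t: "t \<in> S X" "t + q\<^sup>2 \<in> S X" and "q > 0"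
      using sarkozy by blast
    have "\<exists>x\<in>A. \<exists>x'\<in>A. \<forall>i\<in>{1..d}. x i - x' i = q\<^sup>2 * v i" if "v \<in> V" for v
    proof (intro bexI)
      show "shift t v (X v) \<in> A" "shift (t + q\<^sup>2) v (X v) \<in> A"
        using t that unfolding S_def by auto
      show "\<forall>i\<in>{1..d}. shift (t + q\<^sup>2) v (X v) i - shift t v (X v) i = q\<^sup>2 * v i"
        by (simp add: shift_def algebra_simps)
    qed
    then show "\<exists>q>0. \<forall>v\<in>V. \<exists>x\<in>A. \<exists>x'\<in>A. \<forall>i\<in>{1..d}. x i - x' i = q\<^sup>2 * v i"
      using \<open>q > 0\<close> by blast
  qed
qed

section \<open>Homogeneous sets\<close>

theorem theorem2p5:
  fixes \<delta> :: real and d M :: nat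
  assumes "\<delta> > 0" and "d \<ge> 1" and "M \<ge> 1"
  shows "\<exists>N\<^sub>0::real. \<forall>N\<ge>N\<^sub>0. \<forall>(A :: (nat \<Rightarrow> int) set) (B :: nat \<Rightarrow> int set).
           A \<subseteq> box d N \<longrightarrow> real (card A) \<ge> \<delta> * N ^ d \<longrightarrow>
           (\<forall>i\<in>{1..d}. homogeneous M (B i)) \<longrightarrow>
           (\<exists>x\<in>A. \<exists>x'\<in>A. \<exists>y. (\<forall>i\<in>{1..d}. y i \<in> B i) \<and>
              (\<forall>i\<in>{1..d}. x i - x' i = (y i)\<^sup>2))"
proof -
  define V where "V = (\<lambda>m i. (m i)\<^sup>2) ` ({1..d} \<rightarrow>\<^sub>E {1..int M})"
  have "finite V" unfolding V_def by (intro finite_imageI finite_PiE) auto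
  then obtain n\<^sub>0 where n\<^sub>0: "\<And>n A. n\<^sub>0 \<le> n \<Longrightarrow> A \<subseteq> {1..d} \<rightarrow>\<^sub>E {1..int n} \<Longrightarrow>
      \<delta> * real n ^ d \<le> real (card A) \<Longrightarrow>
      \<exists>q>0. \<forall>v\<in>V. \<exists>x\<in>A. \<exists>x'\<in>A. \<forall>i\<in>{1..d}. x i - x' i = q\<^sup>2 * v i"
    using simultaneous_square_recurrence[OF \<open>\<delta> > 0\<close>, of V d] by metis
  show ?thesis
  proof (intro exI[of _ "real n\<^sub>0"] allI impI)
    fix N and A :: "(nat \<Rightarrow> int) set" and B :: "nat \<Rightarrow> int set"
    assume N: "real n\<^sub>0 \<le> N" and A: "A \<subseteq> box d N" and cardA: "\<delta> * N ^ d \<le> real (card A)"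
      and B: "\<forall>i\<in>{1..d}. homogeneous M (B i)"
    define n where "n = nat \<lfloor>N\<rfloor>"
    have n: "int n = \<lfloor>N\<rfloor>" "real n \<le> N" "n\<^sub>0 \<le> n" using N unfolding n_def by linarith+
    have "\<delta> * real n ^ d \<le> \<delta> * N ^ d" using \<open>\<delta> > 0\<close> n by (intro mult_left_mono power_mono) auto
    then obtain q where "q > 0"
      and q: "\<And>v. v \<in> V \<Longrightarrow> \<exists>x\<in>A. \<exists>x'\<in>A. \<forall>i\<in>{1..d}. x i - x' i = q\<^sup>2 * v i"
      using n\<^sub>0[of n A] n A cardA unfolding box_def interval_upto_def by fastforce
    \<comment> \<open>Here \<open>m\<close> depends on \<open>q\<close>; this is harmless since
      \<open>q\<close> was found for all of \<open>V\<close> beforehand.\<close>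
    have "\<exists>m\<in>{1..int M}. q * m \<in> B i" if "i \<in> {1..d}" for i
      using B that \<open>q > 0\<close> unfolding homogeneous_def interval_upto_def by fastforce
    then obtain m where m: "\<And>i. i \<in> {1..d} \<Longrightarrow> m i \<in> {1..int M} \<and> q * m i \<in> B i" by metis
    have "(\<lambda>i. (restrict m {1..d} i)\<^sup>2) \<in> V"
      unfolding V_def using m by (intro imageI) auto
    from q[OF this] obtain x x' where x: "x \<in> A" "x' \<in> A"
      and diff: "\<forall>i\<in>{1..d}. x i - x' i = q\<^sup>2 * (m i)\<^sup>2" by auto
    then show "\<exists>x\<in>A. \<exists>x'\<in>A. \<exists>y. (\<forall>i\<in>{1..d}. y i \<in> B i) \<and> (\<forall>i\<in>{1..d}. x i - x' i = (y i)\<^sup>2)"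
      using m by (intro bexI[of _ x] bexI[of _ x'] exI[of _ "\<lambda>i. q * m i"]) (auto simp: power_mult_distrib)
  qed
qed

end
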